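(* Let $X$ be a compact Polish space and $\alpha\in(0,1)$. For all $\mu,\theta\in\mathcal P(X)$, $$R_\alpha(\mu\mid\theta)=\sup_{\substack{h\in C(X)\\ h<0\ \theta\text{-a.e.}}}\ \langle h,\mu\rangle-\ln\left(\left\langle(-h)^{\frac{\alpha}{\alpha-1}},\theta\right\rangle\right)-C_\alpha,$$ where $C_\alpha:=\frac{\alpha}{1-\alpha}\left(\ln\left(\frac{\alpha}{1-\alpha}\right)-1\right)$.
   Context: $\mathcal P(X)$ is the set of Borel probability measures on $X$, $C(X)$ the continuous real functions, $\langle h,\mu\rangle=\int_X h\,d\mu$. For $\alpha\in(0,1)$ the $\alpha$-Rényi divergence is $R_\alpha(\mu\mid\nu)=\frac1{\alpha-1}\ln\left(\int_X\left(\frac{\rho_\mu}{\rho_\nu}\right)^\alpha d\nu\right)\in[0,\infty]$, where $\rho_\mu,\rho_\nu$ are the densities of $\mu,\nu$ with respect to any $\sigma$-finite non-negative reference measure dominating both (e.g. $\frac12\mu+\frac12\nu$), with $\ln 0=-\infty$.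
   Formalization: The supremum is taken over h in C(X) with h ≤ 0 everywhere and h < 0 θ-a.e.; without h ≤ 0 the formula fails, e.g. for θ = δ_x, μ = (δ_x+δ_y)/2 with x ≠ y, where h(y) can be arbitrarily large, so the supremum is infinite while the divergence is finite. *)

theory Defs
  imports "HOL-Analysis.Analysis" "HOL-Probability.Probability"
begin

text \<open>
  The logarithm on \<open>[0, \<infinity>]\<close>, with \<open>ln 0 = -\<infinity>\<close> and \<open>ln \<infinity> = \<infinity>\<close>.
\<close>

definition eln :: "ennreal \<Rightarrow> ereal" where
  "eln x = (if x = 0 then -\<infinity> else if x = \<top> then \<infinity> else ereal (ln (enn2real x)))"

definition borel_probs :: "'a::topological_space measure set" where
  "borel_probs = {\<mu>. sets \<mu> = sets borel \<and> prob_space \<mu>}"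

text \<open>
  The divergence computed from densities with respect to a reference measure \<open>\<eta>\<close>. The value of
  the ratio where \<open>RN_deriv \<eta> \<nu>\<close> vanishes is irrelevant, since that set is \<open>\<nu>\<close>-null.
\<close>

definition renyi_wrt :: "'a measure \<Rightarrow> real \<Rightarrow> 'a measure \<Rightarrow> 'a measure \<Rightarrow> ereal" where
  "renyi_wrt \<eta> \<alpha> \<mu> \<nu> =
     ereal (1 / (\<alpha> - 1)) *
     eln (\<integral>\<^sup>+x. ennreal ((enn2real (RN_deriv \<eta> \<mu> x) / enn2real (RN_deriv \<eta> \<nu> x)) powr \<alpha>) \<partial>\<nu>)"

definition half_sum :: "'a measure \<Rightarrow> 'a measure \<Rightarrow> 'a measure" where
  "half_sum \<mu> \<nu> = measure_of (space \<mu>) (sets \<mu>) (\<lambda>A. (emeasure \<mu> A + emeasure \<nu> A) / 2)"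

text \<open>
  The choice of the reference measure \<open>\<mu>/2 + \<nu>/2\<close> is immaterial:
  see \<open>renyi_div_eq_renyi_wrt\<close> below.
\<close>

definition renyi_div :: "real \<Rightarrow> 'a measure \<Rightarrow> 'a measure \<Rightarrow> ereal" where
  "renyi_div \<alpha> \<mu> \<nu> = renyi_wrt (half_sum \<mu> \<nu>) \<alpha> \<mu> \<nu>"

text \<open>
  The functions \<open>h \<in> C(X)\<close> with \<open>h < 0\<close> \<open>\<theta>\<close>-almost everywhere over which the supremum is taken.
  Since \<open>-h\<close> is raised to a real power, it is moreover required to be non-negative at every point.
  Without this requirement the variational formula is false: if \<open>\<theta>\<close> is the Dirac measure at \<open>x\<close> and
  \<open>\<mu>\<close> is half the sum of the Dirac measures at \<open>x\<close> and at some \<open>y \<noteq> x\<close>, then \<open>h y\<close> can be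
  arbitrarily large and the supremum is \<open>\<infinity>\<close>, whereas the divergence is finite. If \<open>\<theta>\<close> has full
  support, the requirement follows from the other two.
\<close>

definition test_functions :: "'a::topological_space measure \<Rightarrow> ('a \<Rightarrow> real) set" where
  "test_functions \<theta> = {h. continuous_on UNIV h \<and> (\<forall>x. h x \<le> 0) \<and> (AE x in \<theta>. h x < 0)}"

definition renyi_const :: "real \<Rightarrow> real" where
  "renyi_const \<alpha> = \<alpha> / (1 - \<alpha>) * (ln (\<alpha> / (1 - \<alpha>)) - 1)"

lemma sets_half_sum [simp]: "sets (half_sum \<mu> \<nu>) = sets \<mu>"
  by (simp add: half_sum_def)

lemma space_half_sum [simp]: "space (half_sum \<mu> \<nu>) = space \<mu>"
  by (simp add: half_sum_def)

lemma emeasure_half_sum: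
  assumes "sets \<mu> = sets \<nu>" and A: "A \<in> sets \<mu>"
  shows "emeasure (half_sum \<mu> \<nu>) A = (emeasure \<mu> A + emeasure \<nu> A) / 2"
proof (rule emeasure_measure_of[OF half_sum_def])
  show "countably_additive (sets (half_sum \<mu> \<nu>)) (\<lambda>A. (emeasure \<mu> A + emeasure \<nu> A) / 2)"
  proof (rule countably_additiveI)
    fix F :: "nat \<Rightarrow> 'a set"
    assume F: "range F \<subseteq> sets (half_sum \<mu> \<nu>)" "disjoint_family F"
    have 1: "(\<Sum>i. emeasure \<mu> (F i)) = emeasure \<mu> (\<Union>i. F i)"
      "(\<Sum>i. emeasure \<nu> (F i)) = emeasure \<nu> (\<Union>i. F i)"
      using F assms(1) by (auto intro!: suminf_emeasure)
    have "(\<Sum>i. (emeasure \<mu> (F i) + emeasure \<nu> (F i)) / 2)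
        = (\<Sum>i. emeasure \<mu> (F i) + emeasure \<nu> (F i)) / 2"
      by (simp add: divide_ennreal_def)
    also have "(\<Sum>i. emeasure \<mu> (F i) + emeasure \<nu> (F i))
        = (\<Sum>i. emeasure \<mu> (F i)) + (\<Sum>i. emeasure \<nu> (F i))"
      by (intro suminf_add[symmetric]) auto
    finally show "(\<Sum>i. (emeasure \<mu> (F i) + emeasure \<nu> (F i)) / 2)
        = (emeasure \<mu> (\<Union>i. F i) + emeasure \<nu> (\<Union>i. F i)) / 2"
      by (simp add: 1)
  qed
qed (use A in \<open>auto simp: positive_def sets.space_closed\<close>)

lemma finite_measure_half_sum:
  assumes "finite_measure \<mu>" "finite_measure \<nu>" and s: "sets \<mu> = sets \<nu>"
  shows "finite_measure (half_sum \<mu> \<nu>)"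
proof (rule finite_measureI)
  show "emeasure (half_sum \<mu> \<nu>) (space (half_sum \<mu> \<nu>)) \<noteq> \<infinity>"
    using assms sets_eq_imp_space_eq[OF s]
    by (simp add: emeasure_half_sum[OF s] ennreal_divide_eq_top_iff finite_measure.emeasure_eq_measure)
qed

lemma absolutely_continuous_half_sum:
  assumes s: "sets \<mu> = sets \<nu>"
  shows "absolutely_continuous (half_sum \<mu> \<nu>) \<mu>" "absolutely_continuous (half_sum \<mu> \<nu>) \<nu>"
  using s by (auto simp: absolutely_continuous_def null_sets_def emeasure_half_sum[OF s]
      ennreal_divide_eq_0_iff)

lemma renyi_div_eq_renyi_wrt:
  assumes "finite_measure \<mu>" "finite_measure \<nu>" and "sigma_finite_measure \<eta>"
    and sm: "sets \<mu> = sets \<eta>" and sn: "sets \<nu> = sets \<eta>"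
    and am: "absolutely_continuous \<eta> \<mu>" and an: "absolutely_continuous \<eta> \<nu>"
  shows "renyi_div \<alpha> \<mu> \<nu> = renyi_wrt \<eta> \<alpha> \<mu> \<nu>"
proof -
  interpret \<eta>: sigma_finite_measure \<eta> by fact
  interpret \<mu>: finite_measure \<mu> by fact
  interpret \<nu>: finite_measure \<nu> by fact
  define \<kappa> where "\<kappa> = half_sum \<mu> \<nu>"
  interpret \<kappa>: finite_measure \<kappa>
    unfolding \<kappa>_def by (rule finite_measure_half_sum) (use assms in auto)
  have s: "sets \<mu> = sets \<nu>" using sm sn by simp
  have sk: "sets \<kappa> = sets \<eta>" by (simp add: \<kappa>_def sm)
  have ak: "absolutely_continuous \<eta> \<kappa>"
    using am an sm sn
    by (auto simp: absolutely_continuous_def null_sets_def \<kappa>_def emeasure_half_sum[OF s])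
  define k where "k = RN_deriv \<eta> \<kappa>"
  have [measurable]: "k \<in> borel_measurable \<eta>" by (simp add: k_def)
  have dk: "density \<eta> k = \<kappa>"
    unfolding k_def by (rule \<eta>.density_RN_deriv[OF ak sk])
  have chain: "AE x in \<eta>. RN_deriv \<eta> \<rho> x = k x * RN_deriv \<kappa> \<rho> x"
    if "absolutely_continuous \<kappa> \<rho>" "sets \<rho> = sets \<eta>" for \<rho>
  proof -
    have m: "RN_deriv \<kappa> \<rho> \<in> borel_measurable \<eta>"
      using borel_measurable_RN_deriv[of \<kappa> \<rho>] measurable_cong_sets[OF sk refl] by blast
    have "density \<eta> (\<lambda>x. k x * RN_deriv \<kappa> \<rho> x) = density (density \<eta> k) (RN_deriv \<kappa> \<rho>)"
      by (rule density_density_eq[symmetric]) (use m in measurable)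
    also have "\<dots> = \<rho>"
      unfolding dk by (rule \<kappa>.density_RN_deriv) (use that sk in auto)
    finally have "AE x in \<eta>. k x * RN_deriv \<kappa> \<rho> x = RN_deriv \<eta> \<rho> x"
      by (intro \<eta>.RN_deriv_unique) (use m in measurable)
    then show ?thesis by eventually_elim simp
  qed
  have cm: "AE x in \<eta>. RN_deriv \<eta> \<mu> x = k x * RN_deriv \<kappa> \<mu> x"
    by (rule chain) (use absolutely_continuous_half_sum[OF s] sm in \<open>auto simp: \<kappa>_def\<close>)
  have cn: "AE x in \<eta>. RN_deriv \<eta> \<nu> x = k x * RN_deriv \<kappa> \<nu> x"
    by (rule chain) (use absolutely_continuous_half_sum[OF s] sn in \<open>auto simp: \<kappa>_def\<close>)
  have fk: "AE x in \<eta>. k x \<noteq> \<infinity>"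
    unfolding k_def by (rule \<eta>.RN_deriv_finite) (use ak sk \<kappa>.sigma_finite_measure_axioms in auto)
  have dn: "density \<eta> (RN_deriv \<eta> \<nu>) = \<nu>"
    by (rule \<eta>.density_RN_deriv[OF an sn])
  have pos: "AE x in \<nu>. RN_deriv \<eta> \<nu> x > 0"
    by (subst dn[symmetric], subst AE_density) auto
  have "AE x in \<nu>. RN_deriv \<eta> \<mu> x = k x * RN_deriv \<kappa> \<mu> x"
    "AE x in \<nu>. RN_deriv \<eta> \<nu> x = k x * RN_deriv \<kappa> \<nu> x" "AE x in \<nu>. k x \<noteq> \<infinity>"
    using cm cn fk absolutely_continuous_AE[OF sn an] by auto
  with pos have "AE x in \<nu>.
      enn2real (RN_deriv \<kappa> \<mu> x) / enn2real (RN_deriv \<kappa> \<nu> x)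
      = enn2real (RN_deriv \<eta> \<mu> x) / enn2real (RN_deriv \<eta> \<nu> x)"
  proof eventually_elim
    case (elim x)
    then have "enn2real (k x) \<noteq> 0"
      by (auto simp: enn2real_eq_0_iff)
    then show ?case using elim by (simp add: enn2real_mult)
  qed
  then have "(\<integral>\<^sup>+x. ennreal ((enn2real (RN_deriv \<kappa> \<mu> x) / enn2real (RN_deriv \<kappa> \<nu> x)) powr \<alpha>) \<partial>\<nu>)
    = (\<integral>\<^sup>+x. ennreal ((enn2real (RN_deriv \<eta> \<mu> x) / enn2real (RN_deriv \<eta> \<nu> x)) powr \<alpha>) \<partial>\<nu>)"
    by (intro nn_integral_cong_AE) auto
  then show ?thesis by (simp add: renyi_div_def renyi_wrt_def \<kappa>_def)
qed

end

(*
  Let F, G be the densities of mu, theta with respect to mu/2 + theta/2, p = alpha / (1 - alpha) and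
  H = int (F/G)^alpha dtheta, so that the divergence is - (1 + p) ln H.

  Upper bound: for u = -h, A = int u dmu and b = int u^(-p) dtheta, Young's inequality applied to
  u F / (p G) and u^(-p) / b gives H <= p^alpha b^(1 - alpha) (1 - alpha) (1 + A). Since the
  first factor is normalised by p rather than by A, the bound ln x <= x - 1 turns this into
  -A - ln b - C_alpha <= - (1 + p) ln H.

  Attainment: (G/F)^(1 - alpha) is the formal optimiser, with A = b = H. It is clamped to a compact
  subinterval of (0, oo) and then replaced by a continuous function v that is L^1-close for both
  measures. Both integrals stay below any given E > H, and h = - (p / E) v has value at least
  - (1 + p) ln E.
*)

theory Submission
  imports Defs
begin

section \<open>Approximation in mean by continuous functions on a Polish space\<close>

text \<open>Outer regularity gives an open \<open>U\<close> containing \<open>A\<close> whose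
  measure exceeds that of \<open>A\<close> by less than \<open>e / 2\<close>. The indicator of
  \<open>U\<close> is the pointwise limit of truncated multiples of the distance to the complement,
  so dominated convergence costs another \<open>e / 2\<close>.\<close>

lemma continuous_approx_indicator:
  fixes M :: "'a::polish_space measure"
  assumes sets: "sets M = sets borel" and "finite_measure M" and A: "A \<in> sets borel" and "0 < e"
  obtains v :: "'a \<Rightarrow> real" where "continuous_on UNIV v" "integrable M v"
    "(\<integral>x. \<bar>indicator A x - v x\<bar> \<partial>M) < e"
proof -
  interpret finite_measure M by fact
  note [measurable_cong] = sets
  have sp: "space M = UNIV" using sets_eq_imp_space_eq[OF sets] by simp
  have fin: "emeasure M (space M) \<noteq> \<infinity>" by simp
  have "(INF U \<in> {U. A \<subseteq> U \<and> open U}. emeasure M U) < emeasure M A + ennreal (e / 2)"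
    unfolding outer_regular[OF sets fin A, symmetric] using \<open>0 < e\<close>
    by (simp add: emeasure_eq_measure ennreal_less_iff flip: ennreal_plus)
  then obtain U where U: "A \<subseteq> U" "open U" "emeasure M U < emeasure M A + ennreal (e / 2)"
    by (auto simp: INF_less_iff)
  have [measurable]: "U \<in> sets borel" "A \<in> sets borel" using U A by auto
  have UA: "measure M U < measure M A + e / 2"
    using U(3) \<open>0 < e\<close> by (simp add: emeasure_eq_measure ennreal_less_iff flip: ennreal_plus)
  \<comment> \<open>The case \<open>U = UNIV\<close> is separate because \<open>infdist\<close> to
    the empty set is 0 by convention, which would make \<open>w n\<close> vanish
    identically.\<close>
  define w where "w n x = (if U = UNIV then 1 else min 1 (real n * infdist x (- U)))" for n x
  have wc: "continuous_on UNIV (w n)" for n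
    unfolding w_def by (cases "U = UNIV") (auto intro!: continuous_intros)
  have [measurable]: "w n \<in> borel_measurable borel" for n
    using wc by (rule borel_measurable_continuous_onI)
  have w01: "0 \<le> w n x" "w n x \<le> 1" for n x
    by (auto simp: w_def infdist_nonneg)
  have iw: "integrable M (w n)" for n
    by (rule integrable_const_bound[of _ 1]) (use w01 in \<open>auto simp: measurable_cong_sets[OF sets refl]\<close>)
  have iA: "integrable M (indicator A :: 'a \<Rightarrow> real)"
    and iU: "integrable M (indicator U :: 'a \<Rightarrow> real)"
    by (auto simp: emeasure_eq_measure integrable_indicator_iff)
  have lim: "(\<lambda>n. w n x) \<longlonglongrightarrow> indicator U x" for x
  proof (cases "U = UNIV")
    case False
    show ?thesis
    proof (cases "x \<in> U")
      case True
      then have pos: "0 < infdist x (- U)"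
        using False U(2) by (intro infdist_pos_not_in_closed) (auto simp: closed_def)
      obtain N where N: "1 < real N * infdist x (- U)"
        using reals_Archimedean3[OF pos] by blast
      have "w n x = 1" if "n \<ge> N" for n
      proof -
        have "real N * infdist x (- U) \<le> real n * infdist x (- U)"
          using that pos by (intro mult_right_mono) auto
        with N False show ?thesis by (simp add: w_def)
      qed
      then show ?thesis using True
        by (intro tendsto_eventually) (auto simp: eventually_sequentially)
    qed (use False in \<open>simp add: w_def\<close>)
  qed (simp add: w_def)
  have "(\<lambda>n. \<integral>x. \<bar>indicator U x - w n x\<bar> \<partial>M) \<longlonglongrightarrow> (\<integral>x. 0 \<partial>M)"
  proof (rule integral_dominated_convergence[where w = "\<lambda>_. 1"])
    show "AE x in M. (\<lambda>n. \<bar>indicator U x - w n x\<bar>) \<longlonglongrightarrow> 0"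
      using tendsto_rabs_zero[OF LIM_zero[OF lim]] by (auto simp: abs_minus_commute)
    show "AE x in M. norm \<bar>indicator U x - w n x\<bar> \<le> 1" for n
      using w01[of n] by (auto simp: indicator_def)
  qed auto
  then have "\<forall>\<^sub>F n in sequentially. (\<integral>x. \<bar>indicator U x - w n x\<bar> \<partial>M) < e / 2"
    using \<open>0 < e\<close> by (intro order_tendstoD) auto
  then obtain n where n: "(\<integral>x. \<bar>indicator U x - w n x\<bar> \<partial>M) < e / 2"
    by (auto simp: eventually_sequentially)
  have "(\<integral>x. \<bar>indicator A x - w n x\<bar> \<partial>M)
      \<le> (\<integral>x. (indicator U x - indicator A x) + \<bar>indicator U x - w n x\<bar> \<partial>M)"
  proof (rule integral_mono)
    show "\<bar>indicator A x - w n x\<bar> \<le> indicator U x - indicator A x + \<bar>indicator U x - w n x\<bar>" for x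
      using U(1) by (auto simp: indicator_def)
  qed (use iw iA iU in auto)
  also have "\<dots> = (measure M U - measure M A) + (\<integral>x. \<bar>indicator U x - w n x\<bar> \<partial>M)"
    using iw[of n] iA iU by (simp add: sp)
  also have "\<dots> < e" using n UA by simp
  finally show thesis using that wc iw by blast
qed

text \<open>Functions that admit such approximations include multiples of indicators and are closed
  under sums and dominated pointwise limits, which is what the induction principle for integrable
  functions asks for.\<close>

lemma continuous_approx_integrable:
  fixes M :: "'a::polish_space measure" and f :: "'a \<Rightarrow> real"
  assumes sets: "sets M = sets borel" and M: "finite_measure M" and "integrable M f" and "0 < e"
  obtains v where "continuous_on UNIV v" "integrable M v" "(\<integral>x. \<bar>f x - v x\<bar> \<partial>M) < e"
proof -
  \<comment> \<open>The accuracy is quantified inside the induction predicate, so that the induction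
    hypotheses can be used with \<open>e / 2\<close>.\<close>
  have "\<forall>e>0. \<exists>v. continuous_on UNIV v \<and> integrable M v \<and> (\<integral>x. \<bar>f x - v x\<bar> \<partial>M) < e"
    using \<open>integrable M f\<close>
  proof (induction rule: integrable_induct)
    case (base A c)
    show ?case
    proof (intro allI impI)
      fix e :: real assume "0 < e"
      \<comment> \<open>Adding 1 keeps the divisor positive when \<open>c = 0\<close>.\<close>
      then have "0 < e / (\<bar>c\<bar> + 1)" by simp
      with base sets obtain v where v: "continuous_on UNIV v" "integrable M v"
        "(\<integral>x. \<bar>indicator A x - v x\<bar> \<partial>M) < e / (\<bar>c\<bar> + 1)"
        using continuous_approx_indicator[OF sets M, of A] by metis
      have "(\<integral>x. \<bar>indicator A x *\<^sub>R c - v x * c\<bar> \<partial>M) = (\<integral>x. \<bar>indicator A x - v x\<bar> * \<bar>c\<bar> \<partial>M)"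
        by (intro Bochner_Integration.integral_cong refl) (simp flip: abs_mult add: algebra_simps)
      also have "\<dots> = (\<integral>x. \<bar>indicator A x - v x\<bar> \<partial>M) * \<bar>c\<bar>"
        by simp
      also have "\<dots> \<le> e / (\<bar>c\<bar> + 1) * \<bar>c\<bar>"
        using v(3) by (intro mult_right_mono) auto
      also have "\<dots> < e"
        using \<open>0 < e\<close> by (simp add: divide_simps)
      finally show "\<exists>v. continuous_on UNIV v \<and> integrable M v
          \<and> (\<integral>x. \<bar>indicator A x *\<^sub>R c - v x\<bar> \<partial>M) < e"
        using v by (intro exI[of _ "\<lambda>x. v x * c"]) (auto intro!: continuous_intros)
    qed
  next
    case (add f g)
    show ?case
    proof (intro allI impI)
      fix e :: real assume "0 < e"
      with add obtain v w where v: "continuous_on UNIV v" "integrable M v"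
        "(\<integral>x. \<bar>f x - v x\<bar> \<partial>M) < e / 2"
        and w: "continuous_on UNIV w" "integrable M w" "(\<integral>x. \<bar>g x - w x\<bar> \<partial>M) < e / 2"
        by (meson half_gt_zero)
      have "(\<integral>x. \<bar>f x + g x - (v x + w x)\<bar> \<partial>M) \<le> (\<integral>x. \<bar>f x - v x\<bar> + \<bar>g x - w x\<bar> \<partial>M)"
        using add v w by (intro integral_mono) auto
      also have "\<dots> = (\<integral>x. \<bar>f x - v x\<bar> \<partial>M) + (\<integral>x. \<bar>g x - w x\<bar> \<partial>M)"
        using add v w by simp
      finally show "\<exists>v. continuous_on UNIV v \<and> integrable M v
          \<and> (\<integral>x. \<bar>f x + g x - v x\<bar> \<partial>M) < e"
        using v w by (intro exI[of _ "\<lambda>x. v x + w x"]) (auto intro!: continuous_intros)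
    qed
  next
    case (lim f s)
    show ?case
    proof (intro allI impI)
      fix e :: real assume "0 < e"
      have "(\<lambda>i. \<integral>x. \<bar>f x - s i x\<bar> \<partial>M) \<longlonglongrightarrow> (\<integral>x. 0 \<partial>M)"
      \<comment> \<open>The approximants satisfy
        \<open>\<bar>s i x\<bar> \<le> 2 * \<bar>f x\<bar>\<close>, hence the factor 3.\<close>
      proof (rule integral_dominated_convergence[where w = "\<lambda>x. 3 * \<bar>f x\<bar>"])
        show "AE x in M. (\<lambda>i. \<bar>f x - s i x\<bar>) \<longlonglongrightarrow> 0"
          using tendsto_rabs_zero[OF LIM_zero[OF lim.hyps(2)]] by (auto simp: abs_minus_commute)
        show "AE x in M. norm \<bar>f x - s i x\<bar> \<le> 3 * \<bar>f x\<bar>" for i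
          using lim.hyps(3)[of _ i] by (intro AE_I2) (fastforce simp: abs_if split: if_splits)
      qed (use lim in auto)
      then have "\<forall>\<^sub>F i in sequentially. (\<integral>x. \<bar>f x - s i x\<bar> \<partial>M) < e / 2"
        using \<open>0 < e\<close> by (intro order_tendstoD) auto
      then obtain i where i: "(\<integral>x. \<bar>f x - s i x\<bar> \<partial>M) < e / 2"
        by (auto simp: eventually_sequentially)
      obtain v where v: "continuous_on UNIV v" "integrable M v"
        "(\<integral>x. \<bar>s i x - v x\<bar> \<partial>M) < e / 2"
        using lim.IH[of i] \<open>0 < e\<close> by (meson half_gt_zero)
      have "(\<integral>x. \<bar>f x - v x\<bar> \<partial>M) \<le> (\<integral>x. \<bar>f x - s i x\<bar> + \<bar>s i x - v x\<bar> \<partial>M)"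
        using lim v by (intro integral_mono) auto
      also have "\<dots> = (\<integral>x. \<bar>f x - s i x\<bar> \<partial>M) + (\<integral>x. \<bar>s i x - v x\<bar> \<partial>M)"
        using lim v by simp
      finally show "\<exists>v. continuous_on UNIV v \<and> integrable M v \<and> (\<integral>x. \<bar>f x - v x\<bar> \<partial>M) < e"
        using v i by (intro exI[of _ v]) auto
    qed
  qed
  with \<open>0 < e\<close> that show thesis by blast
qed

text \<open>Each of the two measures is dominated by their sum, which is twice
  \<open>half_sum\<close>. A single approximation with respect to \<open>half_sum\<close> therefore
  serves both measures.\<close>

lemma nn_integral_le_half_sum:
  assumes s: "sets \<mu> = sets \<nu>" and f: "f \<in> borel_measurable \<mu>"
  shows "(\<integral>\<^sup>+x. f x \<partial>\<mu>) \<le> 2 * (\<integral>\<^sup>+x. f x \<partial>half_sum \<mu> \<nu>)"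
    and "(\<integral>\<^sup>+x. f x \<partial>\<nu>) \<le> 2 * (\<integral>\<^sup>+x. f x \<partial>half_sum \<mu> \<nu>)"
proof -
  have f': "f \<in> borel_measurable (half_sum \<mu> \<nu>)"
    using f measurable_cong_sets[OF sets_half_sum refl] by blast
  have two: "2 * (x / 2) = x" for x :: ennreal
    by (simp add: ennreal_times_divide mult_divide_eq_ennreal mult.commute[of 2])
  have "(\<integral>\<^sup>+x. f x \<partial>\<rho>) \<le> (\<integral>\<^sup>+x. f x \<partial>scale_measure 2 (half_sum \<mu> \<nu>))"
    if "\<rho> = \<mu> \<or> \<rho> = \<nu>" for \<rho>
  proof (rule nn_integral_mono_measure)
    show "sets \<rho> = sets (scale_measure 2 (half_sum \<mu> \<nu>))"
      using that s by auto
    then show "\<rho> \<le> scale_measure 2 (half_sum \<mu> \<nu>)"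
      using that s by (subst le_measure) (auto simp: le_fun_def emeasure_half_sum two emeasure_notin_sets)
  qed
  then show "(\<integral>\<^sup>+x. f x \<partial>\<mu>) \<le> 2 * (\<integral>\<^sup>+x. f x \<partial>half_sum \<mu> \<nu>)"
    and "(\<integral>\<^sup>+x. f x \<partial>\<nu>) \<le> 2 * (\<integral>\<^sup>+x. f x \<partial>half_sum \<mu> \<nu>)"
    by (simp_all add: nn_integral_scale_measure[OF f'])
qed

text \<open>Approximation to within \<open>e / 2\<close> for \<open>half_sum\<close> becomes
  \<open>e\<close> for each measure. Clamping the approximant to \<open>[a, b]\<close> preserves
  continuity and does not increase its distance to \<open>u\<close>, whose values already lie
  there.\<close>

lemma continuous_approx_pair:
  fixes \<mu> \<theta> :: "'a::polish_space measure" and u :: "'a \<Rightarrow> real"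
  assumes sets: "sets \<mu> = sets borel" "sets \<theta> = sets borel"
    and fin: "finite_measure \<mu>" "finite_measure \<theta>"
    and u [measurable]: "u \<in> borel_measurable borel"
    and ab: "\<And>x. a \<le> u x" "\<And>x. u x \<le> b" and "0 < e"
  obtains v where "continuous_on UNIV v" "\<And>x. a \<le> v x" "\<And>x. v x \<le> b"
    "(\<integral>\<^sup>+x. ennreal \<bar>u x - v x\<bar> \<partial>\<mu>) \<le> ennreal e"
    "(\<integral>\<^sup>+x. ennreal \<bar>u x - v x\<bar> \<partial>\<theta>) \<le> ennreal e"
proof -
  note [measurable_cong] = sets
  define M where "M = half_sum \<mu> \<theta>"
  have s: "sets \<mu> = sets \<theta>" by (simp add: sets)
  have sM [measurable_cong]: "sets M = sets borel" by (simp add: M_def sets)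
  interpret finite_measure M
    unfolding M_def by (rule finite_measure_half_sum[OF fin s])
  have "integrable M u"
  proof (rule integrable_const_bound[of _ "\<bar>a\<bar> + \<bar>b\<bar>"])
    show "AE x in M. norm (u x) \<le> \<bar>a\<bar> + \<bar>b\<bar>"
    proof (rule AE_I2)
      fix x show "norm (u x) \<le> \<bar>a\<bar> + \<bar>b\<bar>"
        using ab(1)[of x] ab(2)[of x] by (auto simp: abs_if)
    qed
  qed measurable
  then obtain w where w: "continuous_on UNIV w" "integrable M w" "(\<integral>x. \<bar>u x - w x\<bar> \<partial>M) < e / 2"
    using continuous_approx_integrable[OF sM finite_measure_axioms, of u "e / 2"] \<open>0 < e\<close>
    by (metis half_gt_zero)
  have [measurable]: "w \<in> borel_measurable borel"
    using w(1) by (rule borel_measurable_continuous_onI)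
  define v where "v x = max a (min b (w x))" for x
  have "a \<le> b" using ab order_trans by blast
  have le: "\<bar>u x - v x\<bar> \<le> \<bar>u x - w x\<bar>" for x
    using ab(1)[of x] ab(2)[of x] by (auto simp: v_def max_def min_def)
  have [measurable]: "v \<in> borel_measurable borel" by (simp add: v_def[abs_def])
  have "(\<integral>\<^sup>+x. ennreal \<bar>u x - v x\<bar> \<partial>M) \<le> (\<integral>\<^sup>+x. ennreal \<bar>u x - w x\<bar> \<partial>M)"
    by (intro nn_integral_mono ennreal_leI le)
  also have "\<dots> = ennreal (\<integral>x. \<bar>u x - w x\<bar> \<partial>M)"
    using \<open>integrable M u\<close> w(2) by (intro nn_integral_eq_integral) auto
  also have "\<dots> \<le> ennreal (e / 2)"
    using w(3) by (intro ennreal_leI) simp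
  finally have "2 * (\<integral>\<^sup>+x. ennreal \<bar>u x - v x\<bar> \<partial>M) \<le> 2 * ennreal (e / 2)"
    by (rule mult_left_mono) simp
  also have "\<dots> = ennreal e"
    using \<open>0 < e\<close> by (simp flip: ennreal_numeral ennreal_mult)
  finally have e: "2 * (\<integral>\<^sup>+x. ennreal \<bar>u x - v x\<bar> \<partial>M) \<le> ennreal e" .
  have m: "(\<lambda>x. ennreal \<bar>u x - v x\<bar>) \<in> borel_measurable \<mu>" by measurable
  show thesis
  proof (rule that)
    show "continuous_on UNIV v"
      unfolding v_def using w(1) by (intro continuous_intros)
    show "a \<le> v x" "v x \<le> b" for x using \<open>a \<le> b\<close> by (auto simp: v_def)
    show "(\<integral>\<^sup>+x. ennreal \<bar>u x - v x\<bar> \<partial>\<mu>) \<le> ennreal e"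
      "(\<integral>\<^sup>+x. ennreal \<bar>u x - v x\<bar> \<partial>\<theta>) \<le> ennreal e"
      using nn_integral_le_half_sum[OF s m] e unfolding M_def by (auto intro: order_trans)
  qed
qed

section \<open>Pointwise inequalities for real powers\<close>

text \<open>By the mean value theorem, since the derivative of \<open>x powr - p\<close> is at most
  \<open>p * a powr (- p - 1)\<close> in modulus beyond \<open>a\<close>. For
  \<open>x \<le> y\<close> monotonicity suffices. This carries closeness in mean over to the
  negative powers.\<close>

lemma powr_neg_lipschitz:
  fixes a p x y :: real
  assumes "0 < a" "0 < p" "a \<le> x" "a \<le> y"
  shows "y powr - p \<le> x powr - p + p * a powr (- p - 1) * \<bar>x - y\<bar>"
proof (cases "y < x")
  case True
  have "\<exists>z. y < z \<and> z < x \<and> x powr - p - y powr - p = (x - y) * (- p * z powr (- p - 1))"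
    using assms True
    by (intro MVT2) (auto intro!: derivative_eq_intros simp: field_simps powr_diff)
  then obtain z where z: "y < z" "z < x" "x powr - p - y powr - p = (x - y) * (- p * z powr (- p - 1))"
    by blast
  have "z powr (- p - 1) \<le> a powr (- p - 1)"
    using assms z by (intro powr_mono2') auto
  then have "(x - y) * (p * z powr (- p - 1)) \<le> (x - y) * (p * a powr (- p - 1))"
    using assms True by (intro mult_left_mono) auto
  with z(3) True show ?thesis by (simp add: algebra_simps)
next
  case False
  then have "y powr - p \<le> x powr - p"
    using assms by (intro powr_mono2') auto
  then show ?thesis using assms by (intro add_increasing2) auto
qed

text \<open>Young's inequality with weights \<open>\<alpha>\<close> and \<open>1 - \<alpha>\<close>
  is applied to \<open>u * r / p\<close> and \<open>u powr - p / b\<close>. The powers of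
  \<open>u\<close> cancel on the left because \<open>p * (1 - \<alpha>) = \<alpha>\<close>, and
  \<open>\<alpha> / p = 1 - \<alpha>\<close> gives both terms on the right the same weight.\<close>

lemma young_powr:
  fixes \<alpha> r u b :: real
  assumes "0 < \<alpha>" "\<alpha> < 1" "0 \<le> r" "0 < u" "0 < b"
  defines "p \<equiv> \<alpha> / (1 - \<alpha>)"
  shows "r powr \<alpha> \<le> p powr \<alpha> * b powr (1 - \<alpha>) * (1 - \<alpha>) * (u * r + u powr - p / b)"
proof (cases "r = 0")
  case True
  then show ?thesis using assms by simp
next
  case False
  have p: "0 < p" "p * (1 - \<alpha>) = \<alpha>" using assms by (auto simp: p_def)
  have "(u * r / p) powr \<alpha> * (u powr - p / b) powr (1 - \<alpha>)
      \<le> \<alpha> * (u * r / p) + (1 - \<alpha>) * (u powr - p / b)"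
    using assms p False by (intro Youngs_inequality_0) auto
  also have "\<alpha> * (u * r / p) = (1 - \<alpha>) * (u * r)"
  proof -
    have "\<alpha> / p = 1 - \<alpha>" using p by (simp add: divide_eq_eq mult.commute)
    then show ?thesis by (metis mult.commute times_divide_eq_left times_divide_eq_right)
  qed
  finally have le: "(u * r / p) powr \<alpha> * (u powr - p / b) powr (1 - \<alpha>)
      \<le> (1 - \<alpha>) * (u * r + u powr - p / b)" by (simp add: algebra_simps)
  have "p powr \<alpha> * b powr (1 - \<alpha>) * ((u * r / p) powr \<alpha> * (u powr - p / b) powr (1 - \<alpha>))
      = r powr \<alpha>"
  proof -
    have "(u powr - p) powr (1 - \<alpha>) = u powr - \<alpha>"
      by (simp add: powr_powr p(2))
    moreover have "u powr \<alpha> * u powr - \<alpha> = 1"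
      using assms by (simp flip: powr_add)
    moreover have "p powr \<alpha> \<noteq> 0" "b powr (1 - \<alpha>) \<noteq> 0"
      using assms p by auto
    ultimately show ?thesis
      using assms p by (simp add: powr_mult powr_divide)
  qed
  then have "r powr \<alpha> = p powr \<alpha> * b powr (1 - \<alpha>)
      * ((u * r / p) powr \<alpha> * (u powr - p / b) powr (1 - \<alpha>))" ..
  also have "\<dots> \<le> p powr \<alpha> * b powr (1 - \<alpha>) * ((1 - \<alpha>) * (u * r + u powr - p / b))"
    by (rule mult_left_mono[OF le]) simp
  finally show ?thesis by (simp only: mult.assoc)
qed

section \<open>Bounds for the integral of the density ratio\<close>

text \<open>\<open>young_powr\<close> with \<open>r = F x / G x\<close> is integrated against
  \<open>density M G\<close>, for which positivity of \<open>u\<close> almost everywhere is enough.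
  The ratio term contributes at most \<open>A\<close>, and the power term exactly 1 because of the
  division by \<open>b\<close>.\<close>

lemma nn_integral_powr_ratio_le:
  fixes F G u :: "'a \<Rightarrow> real" and \<alpha> A b :: real
  assumes \<alpha>: "0 < \<alpha>" "\<alpha> < 1"
    and [measurable]: "F \<in> borel_measurable M" "G \<in> borel_measurable M" "u \<in> borel_measurable M"
    and nn: "\<And>x. 0 \<le> F x" "\<And>x. 0 \<le> G x" "\<And>x. 0 \<le> u x"
    and pos: "AE x in density M G. 0 < u x"
    and A: "(\<integral>\<^sup>+x. ennreal (u x) \<partial>density M F) = ennreal A" "0 \<le> A"
    and b: "(\<integral>\<^sup>+x. ennreal (u x powr - (\<alpha> / (1 - \<alpha>))) \<partial>density M G) = ennreal b" "0 < b"
  shows "(\<integral>\<^sup>+x. ennreal ((F x / G x) powr \<alpha>) \<partial>density M G)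
    \<le> ennreal ((\<alpha> / (1 - \<alpha>)) powr \<alpha> * b powr (1 - \<alpha>) * ((1 - \<alpha>) * (1 + A)))"
proof -
  define p where "p = \<alpha> / (1 - \<alpha>)"
  define K where "K = p powr \<alpha> * b powr (1 - \<alpha>) * (1 - \<alpha>)"
  have K: "0 \<le> K" using \<alpha> by (simp add: K_def)
  have "(\<integral>\<^sup>+x. ennreal ((F x / G x) powr \<alpha>) \<partial>density M G)
      \<le> (\<integral>\<^sup>+x. ennreal K * (ennreal (u x * (F x / G x)) + ennreal (u x powr - p) / ennreal b) \<partial>density M G)"
  proof (rule nn_integral_mono_AE)
    show "AE x in density M G. ennreal ((F x / G x) powr \<alpha>)
        \<le> ennreal K * (ennreal (u x * (F x / G x)) + ennreal (u x powr - p) / ennreal b)"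
      using pos
    proof eventually_elim
      case (elim x)
      have "(F x / G x) powr \<alpha> \<le> K * (u x * (F x / G x) + u x powr - p / b)"
        unfolding K_def p_def using \<alpha> elim nn b(2) by (intro young_powr) auto
      then show ?case
        using K nn elim b(2)
        by (simp add: divide_ennreal flip: ennreal_plus ennreal_mult)
    qed
  qed
  also have "\<dots> = ennreal K * ((\<integral>\<^sup>+x. ennreal (u x * (F x / G x)) \<partial>density M G)
      + (\<integral>\<^sup>+x. ennreal (u x powr - p) \<partial>density M G) / ennreal b)"
    by (simp add: nn_integral_cmult nn_integral_add nn_integral_divide)
  also have "(\<integral>\<^sup>+x. ennreal (u x * (F x / G x)) \<partial>density M G)
      = (\<integral>\<^sup>+x. ennreal (G x) * ennreal (u x * (F x / G x)) \<partial>M)"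
    by (rule nn_integral_density) auto
  \<comment> \<open>Only an inequality: where \<open>G\<close> vanishes the left integrand is 0,
    while \<open>density M F\<close> may still have mass there.\<close>
  also have "\<dots> \<le> (\<integral>\<^sup>+x. ennreal (F x) * ennreal (u x) \<partial>M)"
  proof (rule nn_integral_mono)
    fix x
    have "G x * (u x * (F x / G x)) \<le> F x * u x" using nn by (cases "G x = 0") auto
    then show "ennreal (G x) * ennreal (u x * (F x / G x)) \<le> ennreal (F x) * ennreal (u x)"
      using nn by (simp add: ennreal_leI flip: ennreal_mult)
  qed
  also have "\<dots> = (\<integral>\<^sup>+x. ennreal (u x) \<partial>density M F)"
    by (rule nn_integral_density[symmetric]) auto
  also have "ennreal K * ((\<integral>\<^sup>+x. ennreal (u x) \<partial>density M F)
      + (\<integral>\<^sup>+x. ennreal (u x powr - p) \<partial>density M G) / ennreal b) = ennreal (K * (1 + A))"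
    using A b K unfolding p_def
    by (simp add: ennreal_divide_self add.commute flip: ennreal_plus ennreal_mult ennreal_1)
  finally show ?thesis by (simp add: K_def p_def mult.assoc add_mono mult_left_mono)
qed

text \<open>Without clamping, both integrands reduce to
  \<open>F powr \<alpha> * G powr (1 - \<alpha>)\<close> with respect to \<open>M\<close>. The lower
  cut-off raises the first integral by at most \<open>d\<close> and the upper one raises the second
  by at most \<open>b powr - p\<close>, because both measures have mass 1.\<close>

lemma clamped_ratio_bounds:
  fixes F G :: "'a::topological_space \<Rightarrow> real" and \<alpha> d :: real
  assumes \<alpha>: "0 < \<alpha>" "\<alpha> < 1" and "0 < d"
    and [measurable]: "F \<in> borel_measurable M" "G \<in> borel_measurable M"
    and nn: "\<And>x. 0 \<le> F x" "\<And>x. 0 \<le> G x"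
    and prob: "prob_space (density M F)" "prob_space (density M G)"
  defines "p \<equiv> \<alpha> / (1 - \<alpha>)"
  \<comment> \<open>Chosen so that \<open>b powr - p = d\<close>, making both errors equal.\<close>
  defines "b \<equiv> d powr (- 1 / p)"
  \<comment> \<open>Where \<open>F\<close> vanishes the ratio stands for infinity, but division by
    zero would give 0; the upper cut-off is therefore inserted by hand.\<close>
  defines "u \<equiv> (\<lambda>x. max d (if F x = 0 then b else min b ((G x / F x) powr (1 - \<alpha>))))"
  defines "H \<equiv> (\<integral>\<^sup>+x. ennreal ((F x / G x) powr \<alpha>) \<partial>density M G)"
  shows "(\<integral>\<^sup>+x. ennreal (u x) \<partial>density M F) \<le> H + ennreal d"
    and "(\<integral>\<^sup>+x. ennreal (u x powr - p) \<partial>density M G) \<le> H + ennreal d"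
proof -
  have p: "0 < p" "p * (1 - \<alpha>) = \<alpha>" using \<alpha> by (auto simp: p_def)
  have [measurable]: "u \<in> borel_measurable M" by (simp add: u_def)
  have "(\<integral>\<^sup>+x. ennreal (u x) \<partial>density M F)
      \<le> (\<integral>\<^sup>+x. ennreal ((G x / F x) powr (1 - \<alpha>)) + ennreal d \<partial>density M F)"
  proof (rule nn_integral_mono_AE)
    have "AE x in density M F. 0 < F x"
      by (subst AE_density) auto
    then show "AE x in density M F. ennreal (u x) \<le> ennreal ((G x / F x) powr (1 - \<alpha>)) + ennreal d"
    proof eventually_elim
      case (elim x)
      then have "u x \<le> (G x / F x) powr (1 - \<alpha>) + d" using \<open>0 < d\<close> by (auto simp: u_def)
      then show ?case using \<open>0 < d\<close> by (simp add: ennreal_leI flip: ennreal_plus)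
    qed
  qed
  also have "\<dots> = (\<integral>\<^sup>+x. ennreal ((G x / F x) powr (1 - \<alpha>)) \<partial>density M F) + ennreal d"
    using prob_space.emeasure_space_1[OF prob(1)] by (simp add: nn_integral_add)
  also have "(\<integral>\<^sup>+x. ennreal ((G x / F x) powr (1 - \<alpha>)) \<partial>density M F) = H"
  proof -
    have "F x * (G x / F x) powr (1 - \<alpha>) = G x * (F x / G x) powr \<alpha>" for x
      using nn[of x]
      by (cases "F x = 0 \<or> G x = 0") (auto simp: powr_divide powr_diff field_simps)
    then have "ennreal (F x) * ennreal ((G x / F x) powr (1 - \<alpha>))
        = ennreal (G x) * ennreal ((F x / G x) powr \<alpha>)" for x
      using nn[of x] by (simp flip: ennreal_mult)
    then show ?thesis by (simp add: H_def nn_integral_density)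
  qed
  finally show "(\<integral>\<^sup>+x. ennreal (u x) \<partial>density M F) \<le> H + ennreal d" .
  have bp: "b powr - p = d" using p(1) \<open>0 < d\<close> by (simp add: b_def powr_powr)
  have b: "0 < b" using \<open>0 < d\<close> by (simp add: b_def)
  have "(\<integral>\<^sup>+x. ennreal (u x powr - p) \<partial>density M G)
      \<le> (\<integral>\<^sup>+x. ennreal ((F x / G x) powr \<alpha>) + ennreal d \<partial>density M G)"
  proof (rule nn_integral_mono_AE)
    have "AE x in density M G. 0 < G x"
      by (subst AE_density) auto
    then show "AE x in density M G. ennreal (u x powr - p) \<le> ennreal ((F x / G x) powr \<alpha>) + ennreal d"
    proof eventually_elim
      case (elim x)
      have "u x powr - p \<le> (F x / G x) powr \<alpha> + d"
      proof (cases "F x = 0")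
        case True
        then have "u x powr - p \<le> b powr - p"
          using b p by (intro powr_mono2') (auto simp: u_def)
        then show ?thesis using True by (simp add: bp)
      next
        case False
        then have F: "0 < F x" using nn[of x] by simp
        let ?y = "(G x / F x) powr (1 - \<alpha>)"
        have y: "0 < ?y" using F elim by simp
        have "u x powr - p \<le> (min b ?y) powr - p"
          using b y p F by (intro powr_mono2') (auto simp: u_def)
        \<comment> \<open>The minimum is one of its two arguments, and both powers are
          non-negative.\<close>
        also have "\<dots> \<le> b powr - p + ?y powr - p"
          by (auto simp: min_def)
        also have "?y powr - p = (F x / G x) powr \<alpha>"
        proof -
          have "(1 - \<alpha>) * - p = - \<alpha>" using p(2) by (simp add: algebra_simps)
          then show ?thesis using F elim
            by (simp add: powr_powr powr_minus_divide powr_divide)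
        qed
        finally show ?thesis by (simp add: bp)
      qed
      then show ?case using \<open>0 < d\<close> by (simp add: ennreal_leI flip: ennreal_plus)
    qed
  qed
  also have "\<dots> = H + ennreal d"
    using prob_space.emeasure_space_1[OF prob(2)] by (simp add: nn_integral_add H_def)
  finally show "(\<integral>\<^sup>+x. ennreal (u x powr - p) \<partial>density M G) \<le> H + ennreal d" .
qed

text \<open>The gap between the integral and \<open>E\<close> is spent in two equal portions
  \<open>d\<close>, one on clamping and one on replacing the clamped ratio by a continuous function.
  The cut-off at \<open>d\<close> also makes the negative power Lipschitz on the range of both
  functions.\<close>

lemma exists_continuous_near_optimal:
  fixes M :: "'a::polish_space measure" and F G :: "'a \<Rightarrow> real" and \<alpha> E :: real
  assumes \<alpha>: "0 < \<alpha>" "\<alpha> < 1" and sM [measurable_cong]: "sets M = sets borel"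
    and FG [measurable]: "F \<in> borel_measurable M" "G \<in> borel_measurable M"
    and nn: "\<And>x. 0 \<le> F x" "\<And>x. 0 \<le> G x"
    and prob: "prob_space (density M F)" "prob_space (density M G)"
    and E: "(\<integral>\<^sup>+x. ennreal ((F x / G x) powr \<alpha>) \<partial>density M G) < ennreal E"
  obtains v a b where "continuous_on UNIV v" "0 < a" "\<And>x. a \<le> v x" "\<And>x. v x \<le> b"
    "(\<integral>\<^sup>+x. ennreal (v x) \<partial>density M F) \<le> ennreal E"
    "(\<integral>\<^sup>+x. ennreal (v x powr - (\<alpha> / (1 - \<alpha>))) \<partial>density M G) \<le> ennreal E"
proof -
  define p where "p = \<alpha> / (1 - \<alpha>)"
  have p: "0 < p" using \<alpha> by (simp add: p_def)
  define H where "H = (\<integral>\<^sup>+x. ennreal ((F x / G x) powr \<alpha>) \<partial>density M G)"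
  have "H < \<top>" using E ennreal_less_top unfolding H_def by (rule less_trans)
  then obtain H' where H': "H = ennreal H'" "0 \<le> H'"
    by (cases H) auto
  define d where "d = (E - H') / 2"
  have d: "0 < d" using E H' by (simp add: d_def H_def[symmetric] ennreal_less_iff)
  define b where "b = d powr (- 1 / p)"
  define u where "u x = max d (if F x = 0 then b else min b ((G x / F x) powr (1 - \<alpha>)))" for x
  have u [measurable]: "u \<in> borel_measurable borel"
  proof -
    have "u \<in> borel_measurable M" by (simp add: u_def[abs_def])
    then show ?thesis using measurable_cong_sets[OF sM refl] by blast
  qed
  have u1: "(\<integral>\<^sup>+x. ennreal (u x) \<partial>density M F) \<le> H + ennreal d"
    and u2: "(\<integral>\<^sup>+x. ennreal (u x powr - p) \<partial>density M G) \<le> H + ennreal d"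
    using clamped_ratio_bounds[OF \<alpha> d FG nn prob]
    by (simp_all only: u_def[abs_def] b_def p_def H_def)
  define L where "L = p * d powr (- p - 1)"
  have L: "0 \<le> L" using p by (simp add: L_def)
  \<comment> \<open>This choice gives \<open>e \<le> d\<close> and \<open>L * e \<le> d\<close> at
    once: the first controls the integral of \<open>v\<close>, the second that of its negative
    power.\<close>
  define e where "e = d / (1 + L)"
  have e: "0 < e" "e \<le> d" "L * e \<le> d"
    using d L by (auto simp: e_def divide_simps algebra_simps)
  \<comment> \<open>The upper bound is \<open>max d b\<close>, since \<open>b\<close> may be smaller
    than \<open>d\<close>.\<close>
  have ub: "\<And>x. d \<le> u x" "\<And>x. u x \<le> max d b" by (auto simp: u_def)
  have sets: "sets (density M F) = sets borel" "sets (density M G) = sets borel"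
    by (simp_all add: sM)
  obtain v where v: "continuous_on UNIV v" "\<And>x. d \<le> v x" "\<And>x. v x \<le> max d b"
    "(\<integral>\<^sup>+x. ennreal \<bar>u x - v x\<bar> \<partial>density M F) \<le> ennreal e"
    "(\<integral>\<^sup>+x. ennreal \<bar>u x - v x\<bar> \<partial>density M G) \<le> ennreal e"
    using continuous_approx_pair[OF sets prob[THEN prob_space.finite_measure] u ub e(1)]
    by blast
  have [measurable]: "v \<in> borel_measurable borel"
    using v(1) by (rule borel_measurable_continuous_onI)
  have v0: "0 < v x" "0 < u x" for x using v(2)[of x] d by (auto simp: u_def)
  have HE: "H + ennreal d + ennreal d = ennreal E"
    using H' d by (simp add: d_def flip: ennreal_plus)
  have "(\<integral>\<^sup>+x. ennreal (v x) \<partial>density M F)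
      \<le> (\<integral>\<^sup>+x. ennreal (u x) + ennreal \<bar>u x - v x\<bar> \<partial>density M F)"
    using v0 by (intro nn_integral_mono) (auto simp flip: ennreal_plus intro!: ennreal_leI simp: less_imp_le)
  also have "\<dots> = (\<integral>\<^sup>+x. ennreal (u x) \<partial>density M F) + (\<integral>\<^sup>+x. ennreal \<bar>u x - v x\<bar> \<partial>density M F)"
    by (intro nn_integral_add) measurable
  also have "\<dots> \<le> (H + ennreal d) + ennreal e"
    by (intro add_mono u1 v(4))
  also have "\<dots> \<le> ennreal E"
    unfolding HE[symmetric] using e by (intro add_mono order_refl ennreal_leI)
  finally have 1: "(\<integral>\<^sup>+x. ennreal (v x) \<partial>density M F) \<le> ennreal E" .
  have "(\<integral>\<^sup>+x. ennreal (v x powr - p) \<partial>density M G)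
      \<le> (\<integral>\<^sup>+x. ennreal (u x powr - p) + ennreal L * ennreal \<bar>u x - v x\<bar> \<partial>density M G)"
  proof (rule nn_integral_mono)
    fix x
    have "v x powr - p \<le> u x powr - p + L * \<bar>u x - v x\<bar>"
      unfolding L_def using d p v(2) by (intro powr_neg_lipschitz) (auto simp: u_def)
    then show "ennreal (v x powr - p) \<le> ennreal (u x powr - p) + ennreal L * ennreal \<bar>u x - v x\<bar>"
      using L by (simp add: ennreal_leI flip: ennreal_plus ennreal_mult)
  qed
  also have "\<dots> = (\<integral>\<^sup>+x. ennreal (u x powr - p) \<partial>density M G)
      + ennreal L * (\<integral>\<^sup>+x. ennreal \<bar>u x - v x\<bar> \<partial>density M G)"
    by (simp add: nn_integral_add nn_integral_cmult)
  also have "\<dots> \<le> (H + ennreal d) + ennreal L * ennreal e"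
    by (intro add_mono u2 mult_left_mono v(5)) simp
  also have "\<dots> \<le> ennreal E"
    unfolding HE[symmetric] using e L by (intro add_mono order_refl) (simp add: ennreal_leI flip: ennreal_mult)
  finally have 2: "(\<integral>\<^sup>+x. ennreal (v x powr - p) \<partial>density M G) \<le> ennreal E" .
  show thesis
    using that[OF v(1) d v(2) v(3)] 1 2 by (simp add: p_def)
qed

section \<open>Passage to logarithms\<close>

text \<open>After taking logarithms, \<open>ln x \<le> x - 1\<close> is used at
  \<open>x = (1 - \<alpha>) * (1 + A)\<close>, where it is sharp for \<open>A = p\<close>. Dividing
  by \<open>1 - \<alpha>\<close> then leaves \<open>p * (ln p - 1)\<close>, which is
  \<open>renyi_const \<alpha>\<close>.\<close>

lemma renyi_bound_ln:
  fixes \<alpha> A b H :: real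
  assumes \<alpha>: "0 < \<alpha>" "\<alpha> < 1" and "0 \<le> A" "0 < b" "0 < H"
    and H: "H \<le> (\<alpha> / (1 - \<alpha>)) powr \<alpha> * b powr (1 - \<alpha>) * ((1 - \<alpha>) * (1 + A))"
  shows "- A - ln b - renyi_const \<alpha> \<le> 1 / (\<alpha> - 1) * ln H"
proof -
  define p where "p = \<alpha> / (1 - \<alpha>)"
  have p: "0 < p" "p * (1 - \<alpha>) = \<alpha>" using \<alpha> by (auto simp: p_def)
  have pos: "0 < (1 - \<alpha>) * (1 + A)" using assms by simp
  have "ln H \<le> ln (p powr \<alpha> * b powr (1 - \<alpha>) * ((1 - \<alpha>) * (1 + A)))"
    using H \<open>0 < H\<close> unfolding p_def by (intro ln_mono) auto
  also have "\<dots> = \<alpha> * ln p + (1 - \<alpha>) * ln b + ln ((1 - \<alpha>) * (1 + A))"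
    using p(1) pos \<open>0 < b\<close>
    by (simp only: ln_mult_pos[OF _ pos] ln_mult_pos ln_powr mult_pos_pos powr_gt_zero simp_thms)
  also have "\<dots> \<le> \<alpha> * ln p + (1 - \<alpha>) * ln b + ((1 - \<alpha>) * (1 + A) - 1)"
    using pos by (intro add_left_mono ln_le_minus_one)
  also have "\<dots> = (1 - \<alpha>) * (A + ln b + p * (ln p - 1))"
  proof -
    have "(1 - \<alpha>) * (A + ln b + p * (ln p - 1))
        = (1 - \<alpha>) * A + (1 - \<alpha>) * ln b + p * (1 - \<alpha>) * (ln p - 1)"
      by (simp add: algebra_simps)
    then show ?thesis unfolding p(2) by (simp add: algebra_simps)
  qed
  finally have "ln H / (1 - \<alpha>) \<le> A + ln b + p * (ln p - 1)"
    using \<alpha> by (simp add: divide_le_eq mult.commute)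
  moreover have "1 / (\<alpha> - 1) * ln H = - (ln H / (1 - \<alpha>))"
    using \<alpha> by (simp add: divide_simps) (simp add: algebra_simps)
  ultimately show ?thesis by (simp add: renyi_const_def p_def)
qed

lemma eln_le_ln:
  assumes "x \<le> ennreal y" "0 < y"
  shows "eln x \<le> ereal (ln y)"
proof (cases x)
  case (real r)
  then show ?thesis using assms by (auto simp: eln_def)
qed (use assms in \<open>auto simp: top_unique\<close>)

section \<open>Real-valued densities and the variational formula\<close>

text \<open>The Radon-Nikodym derivative of a finite measure is finite almost everywhere, so
  truncating it to a real number does not change the density. The quotients in
  \<open>renyi_wrt\<close> thus become quotients of genuine real densities.\<close>

lemma real_density_half_sum:
  assumes "finite_measure \<mu>" "finite_measure \<nu>" and s: "sets \<mu> = sets \<nu>"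
    and \<rho>: "\<rho> = \<mu> \<or> \<rho> = \<nu>"
  shows "density (half_sum \<mu> \<nu>) (\<lambda>x. ennreal (enn2real (RN_deriv (half_sum \<mu> \<nu>) \<rho> x))) = \<rho>"
proof -
  interpret finite_measure "half_sum \<mu> \<nu>" by (rule finite_measure_half_sum[OF assms(1-3)])
  interpret \<rho>: finite_measure \<rho> using assms by auto
  have ac: "absolutely_continuous (half_sum \<mu> \<nu>) \<rho>"
    using absolutely_continuous_half_sum[OF s] \<rho> by auto
  have s\<rho>: "sets \<rho> = sets (half_sum \<mu> \<nu>)" using \<rho> s by auto
  have "AE x in half_sum \<mu> \<nu>. RN_deriv (half_sum \<mu> \<nu>) \<rho> x \<noteq> \<infinity>"
    by (rule RN_deriv_finite[OF \<rho>.sigma_finite_measure_axioms ac s\<rho>])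
  then have "density (half_sum \<mu> \<nu>) (\<lambda>x. ennreal (enn2real (RN_deriv (half_sum \<mu> \<nu>) \<rho> x)))
      = density (half_sum \<mu> \<nu>) (RN_deriv (half_sum \<mu> \<nu>) \<rho>)"
    by (intro density_cong) (auto simp: less_top)
  also have "\<dots> = \<rho>" by (rule density_RN_deriv[OF ac s\<rho>])
  finally show ?thesis .
qed

theorem theorem2p4:
  fixes \<mu> \<theta> :: "'a::polish_space measure" and \<alpha> :: real
  assumes "compact (UNIV :: 'a set)"
    and "0 < \<alpha>" and "\<alpha> < 1"
    and "\<mu> \<in> borel_probs" and "\<theta> \<in> borel_probs"
  shows "renyi_div \<alpha> \<mu> \<theta> =
    (SUP h \<in> test_functions \<theta>.
       ereal (\<integral>x. h x \<partial>\<mu>)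
       - eln (\<integral>\<^sup>+x. ennreal ((- h x) powr (\<alpha> / (\<alpha> - 1))) \<partial>\<theta>)
       - ereal (renyi_const \<alpha>))" (is "_ = (SUP h \<in> _. ?J h)")
proof -
  note \<alpha> = \<open>0 < \<alpha>\<close> \<open>\<alpha> < 1\<close>
  have \<mu>: "sets \<mu> = sets borel" "prob_space \<mu>" and \<theta>: "sets \<theta> = sets borel" "prob_space \<theta>"
    using assms(4,5) by (auto simp: borel_probs_def)
  note [measurable_cong] = \<mu>(1) \<theta>(1)
  interpret \<mu>: prob_space \<mu> by fact
  interpret \<theta>: prob_space \<theta> by fact
  have s: "sets \<mu> = sets \<theta>" using \<mu> \<theta> by simp
  define M where "M = half_sum \<mu> \<theta>"
  have sM [measurable_cong]: "sets M = sets borel" by (simp add: M_def \<mu>)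
  define F where "F x = enn2real (RN_deriv M \<mu> x)" for x
  define G where "G x = enn2real (RN_deriv M \<theta> x)" for x
  have FG [measurable]: "F \<in> borel_measurable M" "G \<in> borel_measurable M"
    by (simp_all add: F_def[abs_def] G_def[abs_def])
  have nn: "0 \<le> F x" "0 \<le> G x" for x by (simp_all add: F_def G_def)
  have dF: "density M F = \<mu>" and dG: "density M G = \<theta>"
    unfolding F_def G_def M_def
    by (simp_all add: real_density_half_sum s \<mu>.finite_measure_axioms \<theta>.finite_measure_axioms)
  define p where "p = \<alpha> / (1 - \<alpha>)"
  have p: "0 < p" "1 + p = 1 / (1 - \<alpha>)" and q: "\<alpha> / (\<alpha> - 1) = - p"
    using \<alpha> by (auto simp: p_def field_simps)
  define H where "H = (\<integral>\<^sup>+x. ennreal ((F x / G x) powr \<alpha>) \<partial>\<theta>)"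
  have R: "renyi_div \<alpha> \<mu> \<theta> = ereal (1 / (\<alpha> - 1)) * eln H"
    by (simp add: renyi_div_def renyi_wrt_def H_def F_def G_def M_def)
  have neg: "1 / (\<alpha> - 1) < 0" using \<alpha> by simp
  show ?thesis
  proof (rule antisym)
    show "renyi_div \<alpha> \<mu> \<theta> \<le> (SUP h \<in> test_functions \<theta>. ?J h)"
    \<comment> \<open>Working with an arbitrary \<open>y\<close> strictly below the divergence
      treats finite and infinite divergence together.\<close>
    proof (rule dense_le)
      fix y assume y: "y < renyi_div \<alpha> \<mu> \<theta>"
      show "y \<le> (SUP h \<in> test_functions \<theta>. ?J h)"
      proof (cases y)
        case (real z)
        \<comment> \<open>The solution of \<open>1 / (\<alpha> - 1) * ln E = z\<close>. As the
          factor is negative, \<open>z\<close> lying below the divergence means that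
          \<open>H\<close> lies below \<open>E\<close>.\<close>
        define E where "E = exp (- (1 - \<alpha>) * z)"
        have E: "0 < E" "ln E = - (1 - \<alpha>) * z" by (simp_all add: E_def)
        have "H < ennreal E"
        proof (cases H)
          case (real r)
          show ?thesis
          proof (cases "r = 0")
            case False
            then have "0 < r" using real by simp
            then have "z < 1 / (\<alpha> - 1) * ln r"
              using y real \<open>y = ereal z\<close> unfolding R by (simp add: eln_def)
            then have "ln r < ln E"
              using \<alpha> E by (simp add: field_simps)
            then show ?thesis using \<open>0 < r\<close> E(1) real by (simp add: ennreal_less_iff)
          qed (use real E in simp)
        next
          case top
          then show ?thesis using y neg unfolding R by (simp add: eln_def)
        qed
        then have HE: "(\<integral>\<^sup>+x. ennreal ((F x / G x) powr \<alpha>) \<partial>density M G) < ennreal E"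
          by (simp add: H_def dG)
        have prob: "prob_space (density M F)" "prob_space (density M G)"
          using \<mu>(2) \<theta>(2) by (simp_all add: dF dG)
        obtain v a b where v: "continuous_on UNIV v" "0 < a" "\<And>x. a \<le> v x" "\<And>x. v x \<le> b"
          "(\<integral>\<^sup>+x. ennreal (v x) \<partial>\<mu>) \<le> ennreal E"
          "(\<integral>\<^sup>+x. ennreal (v x powr - p) \<partial>\<theta>) \<le> ennreal E"
          using exists_continuous_near_optimal[OF \<alpha> sM FG nn prob HE] unfolding dF dG p_def
          by metis
        have [measurable]: "v \<in> borel_measurable borel"
          using v(1) by (rule borel_measurable_continuous_onI)
        have v0: "0 < v x" for x using v(2) v(3)[of x] by simp
        have iv: "integrable \<mu> v"
          by (rule \<mu>.integrable_const_bound[of _ b]) (use v0 v(4) in \<open>auto simp: abs_of_pos\<close>)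
        have "ennreal (\<integral>x. v x \<partial>\<mu>) \<le> ennreal E"
          using v(5) nn_integral_eq_integral[OF iv] v0 by (simp add: less_imp_le)
        then have A: "(\<integral>x. v x \<partial>\<mu>) \<le> E" using E(1) by (simp add: ennreal_le_iff)
        \<comment> \<open>This scale maximises \<open>- t * E - ln (t powr - p * E)\<close>, the
          lower bound for the objective that the two estimates on \<open>v\<close> provide.\<close>
        define t where "t = p / E"
        have t: "0 < t" using p E by (simp add: t_def)
        define h where "h x = - (t * v x)" for x
        have "h \<in> test_functions \<theta>"
          using v(1) v0 t unfolding test_functions_def h_def
          by (auto intro!: continuous_intros simp: less_imp_le)
        have "t * (\<integral>x. v x \<partial>\<mu>) \<le> t * E" using t A by (intro mult_left_mono) auto
        then have J1: "- p \<le> (\<integral>x. h x \<partial>\<mu>)"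
          using E(1) by (simp add: h_def t_def)
        have "(\<integral>\<^sup>+x. ennreal ((- h x) powr - p) \<partial>\<theta>)
            = (\<integral>\<^sup>+x. ennreal (t powr - p) * ennreal (v x powr - p) \<partial>\<theta>)"
          using t v0 by (intro nn_integral_cong) (simp add: h_def powr_mult less_imp_le ennreal_mult)
        also have "\<dots> = ennreal (t powr - p) * (\<integral>\<^sup>+x. ennreal (v x powr - p) \<partial>\<theta>)"
          by (simp add: nn_integral_cmult)
        also have "\<dots> \<le> ennreal (t powr - p) * ennreal E"
          by (intro mult_left_mono v(6)) simp
        also have "\<dots> = ennreal (t powr - p * E)"
          using E(1) by (simp add: ennreal_mult)
        finally have "eln (\<integral>\<^sup>+x. ennreal ((- h x) powr - p) \<partial>\<theta>) \<le> ereal (ln (t powr - p * E))"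
          by (rule eln_le_ln) (use t E(1) in simp)
        also have "ln (t powr - p * E) = - p * (ln p - ln E) + ln E"
          using t E(1) p by (simp add: ln_mult_pos ln_powr t_def ln_div)
        finally have J2: "eln (\<integral>\<^sup>+x. ennreal ((- h x) powr (\<alpha> / (\<alpha> - 1))) \<partial>\<theta>)
            \<le> ereal (- p * (ln p - ln E) + ln E)" by (simp only: q)
        \<comment> \<open>The terms free of \<open>E\<close> are exactly
          \<open>renyi_const \<alpha>\<close> and cancel.\<close>
        have "- p - (- p * (ln p - ln E) + ln E) - renyi_const \<alpha> = - ((1 + p) * ln E)"
          by (simp add: renyi_const_def p_def[symmetric] algebra_simps)
        also have "\<dots> = z"
          using \<alpha> unfolding p(2) E(2) by (simp add: field_simps)
        finally have "ereal z = ereal (- p) - ereal (- p * (ln p - ln E) + ln E) - ereal (renyi_const \<alpha>)"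
          by simp
        also have "\<dots> \<le> ?J h"
          using J1 J2 by (intro ereal_minus_mono) auto
        also have "\<dots> \<le> (SUP h \<in> test_functions \<theta>. ?J h)"
          by (rule SUP_upper) fact
        finally show ?thesis using real by simp
      qed (use y in auto)
    qed
  next
    show "(SUP h \<in> test_functions \<theta>. ?J h) \<le> renyi_div \<alpha> \<mu> \<theta>"
    proof (rule SUP_least)
      fix h assume "h \<in> test_functions \<theta>"
      then have h: "continuous_on UNIV h" "\<And>x. h x \<le> 0" "AE x in \<theta>. h x < 0"
        by (auto simp: test_functions_def)
      have [measurable]: "h \<in> borel_measurable borel"
        using h(1) by (rule borel_measurable_continuous_onI)
      \<comment> \<open>Compactness enters here: it bounds \<open>h\<close> and so makes it
        integrable for \<open>\<mu>\<close>.\<close>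
      have "bounded (range h)"
        using compact_continuous_image[OF h(1) assms(1)] by (rule compact_imp_bounded)
      then obtain c where c: "\<And>x. \<bar>h x\<bar> \<le> c" by (auto simp: bounded_iff)
      have ih: "integrable \<mu> h"
        by (rule \<mu>.integrable_const_bound[of _ c]) (use c in auto)
      define A where "A = (\<integral>x. - h x \<partial>\<mu>)"
      \<comment> \<open>The sign of \<open>h\<close> is needed at every point, since
        \<open>\<mu>\<close> may charge sets that are null for \<open>\<theta>\<close>.\<close>
      have A0: "0 \<le> A" unfolding A_def using h(2) by (intro Bochner_Integration.integral_nonneg) auto
      have A: "(\<integral>\<^sup>+x. ennreal (- h x) \<partial>\<mu>) = ennreal A"
        unfolding A_def using ih h(2) by (intro nn_integral_eq_integral) auto
      define B where "B = (\<integral>\<^sup>+x. ennreal ((- h x) powr - p) \<partial>\<theta>)"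
      \<comment> \<open>The integrand is positive wherever \<open>h x < 0\<close>, hence almost
        everywhere for a measure of mass 1.\<close>
      have B0: "B \<noteq> 0"
      proof
        assume "B = 0"
        then have "AE x in \<theta>. ennreal ((- h x) powr - p) = 0"
          unfolding B_def by (subst (asm) nn_integral_0_iff_AE) auto
        with h(3) have "AE x in \<theta>. False"
          by eventually_elim (auto simp: ennreal_eq_0_iff)
        then show False by simp
      qed
      have J: "?J h = ereal (- A) - eln B - ereal (renyi_const \<alpha>)"
        by (simp add: A_def B_def q)
      show "?J h \<le> renyi_div \<alpha> \<mu> \<theta>"
      proof (cases B)
        \<comment> \<open>An infinite second integral makes the objective
          \<open>-\<infinity>\<close>.\<close>
        case top
        then show ?thesis unfolding J by (simp add: eln_def)
      next
        case (real b)
        then have b: "0 < b" "eln B = ereal (ln b)"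
          using B0 by (auto simp: eln_def)
        have "H \<le> ennreal (p powr \<alpha> * b powr (1 - \<alpha>) * ((1 - \<alpha>) * (1 + A)))"
          using nn_integral_powr_ratio_le[OF \<alpha> FG _ nn, of "\<lambda>x. - h x" A b] h h(3)[folded dG] A A0 b real
          by (simp add: dF dG H_def B_def p_def)
        moreover have K: "0 \<le> p powr \<alpha> * b powr (1 - \<alpha>) * ((1 - \<alpha>) * (1 + A))"
          using \<alpha> A0 by simp
        ultimately obtain H' where H': "H = ennreal H'" "0 \<le> H'"
          "H' \<le> p powr \<alpha> * b powr (1 - \<alpha>) * ((1 - \<alpha>) * (1 + A))"
          by (cases H) (auto simp: top_unique)
        show ?thesis
        proof (cases "H' = 0")
          \<comment> \<open>For \<open>H = 0\<close> the divergence is \<open>\<infinity>\<close>,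
            because \<open>eln 0 = -\<infinity>\<close> is multiplied by a negative factor.\<close>
          case True
          then show ?thesis using neg H' by (simp add: R eln_def)
        next
          case False
          then have "- A - ln b - renyi_const \<alpha> \<le> 1 / (\<alpha> - 1) * ln H'"
            using H' \<alpha> A0 b(1) unfolding p_def by (intro renyi_bound_ln) auto
          then show ?thesis
            using False H' by (simp add: J R b(2)) (simp add: eln_def)
        qed
      qed
    qed
  qed
qed

end
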